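(* Let $d\ge 2$ be an integer and let $\{\lambda_{sk}: s,k\in\{1,\dots,d\},\ s\neq k\}$ be the (symmetric, i.e. $\lambda_{sk}=\lambda_{ks}$) family of tail dependence coefficients of some $d$-dimensional random vector. (a) If for each $i=1,\dots,d$ $$\sum_{j=1}^{i-1}\left(\max_{j+1\le k\le d}\lambda_{jk}\right)+\sum_{j=i+1}^d\lambda_{ij}\le 1$$ (empty sums being $0$), then there exists a max-mixture vector ${\bf X}=(X_1,\dots,X_d)$ (for some choice of parameters $D$, $(\alpha_j^{(i)})$, $C$) with the same tail dependence coefficients, i.e. for all $s\ne k$ the tail dependence coefficient between $X_s$ and $X_k$ equals $\lambda_{sk}$. (b) If $\lambda_{sk}\le \frac{1}{d-1}$ for each $1\le s<k\le d$, then there exists a max-mixture vector ${\bf X}=(X_1,\dots,X_d)$ (for some choice of parameters $D$, $(\alpha_j^{(i)})$, $C$) with the same tail dependence coefficients, i.e. for all $s\ne k$ the tail dependence coefficient between $X_s$ and $X_k$ equals $\lambda_{sk}$.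
   Context: A unit Fréchet random variable $Z$ has distribution function $P(Z\le x)=e^{-1/x}$ for $x>0$ and $0$ for $x\le 0$. Max-mixture vector: given integers $d\ge2$, $D\ge 1$, constants $\alpha_j^{(i)}\ge 0$ ($i=1,\dots,d$, $j=1,\dots,D$) and $C>0$ with $C\ge \max_{1\le i\le d}\sum_{j=1}^D\alpha_j^{(i)}$, the max-mixture vector with parameters $(D,(\alpha_j^{(i)}),C)$ is ${\bf X}=(X_1,\dots,X_d)$ with $$X_i=\max\left\{\max_{1\le j\le D}\alpha_j^{(i)}Z_j,\ \Big(C-\sum_{j=1}^{D}\alpha_j^{(i)}\Big)Y_i\right\},\qquad i=1,\dots,d,$$ where $Y_1,\dots,Y_d,Z_1,\dots,Z_D$ are independent unit Fréchet random variables. Tail dependence coefficient: for a random vector $(W_1,\dots,W_d)$ with marginal distribution functions $F_{W_i}$, the tail dependence coefficient between $W_s$ and $W_k$ is $$\lambda_{sk}=\lim_{u\uparrow 1}P\big(F_{W_s}(W_s)>u\mid F_{W_k}(W_k)>u\big),$$ assumed to exist when one speaks of the tail dependence coefficients of the vector. *)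

theory Defs
  imports "HOL-Probability.Probability"
begin

definition dist_fun :: "'a measure \<Rightarrow> ('a \<Rightarrow> real) \<Rightarrow> real \<Rightarrow> real" where
  "dist_fun M X = cdf (distr M borel X)"

definition unit_frechet :: "'a measure \<Rightarrow> ('a \<Rightarrow> real) \<Rightarrow> bool" where
  "unit_frechet M Z \<longleftrightarrow> Z \<in> borel_measurable M \<and>
     (\<forall>x. dist_fun M Z x = (if x > 0 then exp (- 1 / x) else 0))"

(* "The tail dependence coefficient between X and Y exists and equals l."
   On a probability space the conditioning event has probability at least 1 - u for 0 < u < 1,
   also when the marginals are not continuous, so the quotient in the library's conditional
   probability never has denominator 0 in the limit. *)
definition has_tail_dependence ::
    "'a measure \<Rightarrow> ('a \<Rightarrow> real) \<Rightarrow> ('a \<Rightarrow> real) \<Rightarrow> real \<Rightarrow> bool" where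
  "has_tail_dependence M X Y l \<longleftrightarrow>
     ((\<lambda>u. \<P>(\<omega> in M. dist_fun M X (X \<omega>) > u \<bar> dist_fun M Y (Y \<omega>) > u)) \<longlongrightarrow> l) (at_left 1)"

(* Vectors are indexed by {1..d}; values at other indices are irrelevant. *)
definition has_tail_dependence_family ::
    "'a measure \<Rightarrow> nat \<Rightarrow> (nat \<Rightarrow> 'a \<Rightarrow> real) \<Rightarrow> (nat \<Rightarrow> nat \<Rightarrow> real) \<Rightarrow> bool" where
  "has_tail_dependence_family M d W lam \<longleftrightarrow>
     (\<forall>s\<in>{1..d}. \<forall>k\<in>{1..d}. s \<noteq> k \<longrightarrow> has_tail_dependence M (W s) (W k) (lam s k))"

(* \<alpha> i j is the coefficient with upper index i (component) and lower index j (factor).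
   The joint family Y_1, ..., Y_d, Z_1, ..., Z_D is indexed by the disjoint sum {1..d} <+> {1..D}. *)
definition max_mixture_vector ::
    "'a measure \<Rightarrow> nat \<Rightarrow> nat \<Rightarrow> (nat \<Rightarrow> nat \<Rightarrow> real) \<Rightarrow> real \<Rightarrow> (nat \<Rightarrow> 'a \<Rightarrow> real) \<Rightarrow> bool" where
  "max_mixture_vector M d D \<alpha> C X \<longleftrightarrow>
     prob_space M \<and> d \<ge> 2 \<and> D \<ge> 1 \<and>
     (\<forall>i\<in>{1..d}. \<forall>j\<in>{1..D}. \<alpha> i j \<ge> 0) \<and>
     C > 0 \<and> C \<ge> (MAX i\<in>{1..d}. \<Sum>j=1..D. \<alpha> i j) \<and>
     (\<exists>Y Z.
        (\<forall>i\<in>{1..d}. unit_frechet M (Y i)) \<and>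
        (\<forall>j\<in>{1..D}. unit_frechet M (Z j)) \<and>
        prob_space.indep_vars M (\<lambda>_. borel) (case_sum Y Z) ({1..d} <+> {1..D}) \<and>
        (\<forall>i\<in>{1..d}. \<forall>\<omega>\<in>space M.
           X i \<omega> = max (MAX j\<in>{1..D}. \<alpha> i j * Z j \<omega>)
                        ((C - (\<Sum>j=1..D. \<alpha> i j)) * Y i \<omega>)))"

end

(* The tail dependence coefficient of X_s and X_k in a max-mixture is the sum over j of
   min(alpha_j^(s), alpha_j^(k)), divided by C. So if every row sum of lam off the diagonal is at
   most 1, one common factor per pair of components realises lam with C = 1; each of the
   hypotheses (a) and (b) bounds these row sums by 1. *)

theory Submission
  imports Defs "HOL-Real_Asymp.Real_Asymp"
begin

section \<open>Distribution functions of scaled Frechet variables\<close>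

lemma (in prob_space) dist_fun_eq:
  assumes "X \<in> borel_measurable M"
  shows "dist_fun M X x = \<P>(\<omega> in M. X \<omega> \<le> x)"
  using assms by (auto simp: dist_fun_def cdf_def measure_distr intro!: arg_cong[where f=prob])

lemma (in prob_space) prob_scaled_frechet_le:
  assumes "unit_frechet M V" "c \<ge> 0" "x > 0"
  shows "\<P>(\<omega> in M. c * V \<omega> \<le> x) = exp (- c / x)"
proof (cases "c = 0")
  case True
  then show ?thesis
    using \<open>x > 0\<close> by (simp add: prob_space)
next
  case False
  with assms have "c > 0" by simp
  have "\<P>(\<omega> in M. c * V \<omega> \<le> x) = \<P>(\<omega> in M. V \<omega> \<le> x / c)"
    using \<open>c > 0\<close> by (simp add: pos_le_divide_eq mult.commute)
  also have "\<dots> = exp (- c / x)"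
    using assms \<open>c > 0\<close> by (simp add: unit_frechet_def flip: dist_fun_eq)
  finally show ?thesis .
qed

lemma (in prob_space) prob_all_scaled_frechet_le:
  assumes "indep_vars (\<lambda>_. borel) V I" "finite I" "I \<noteq> {}"
    and "\<And>i. i \<in> I \<Longrightarrow> unit_frechet M (V i)" "\<And>i. i \<in> I \<Longrightarrow> c i \<ge> 0" "x > 0"
  shows "\<P>(\<omega> in M. \<forall>i\<in>I. c i * V i \<omega> \<le> x) = exp (- (\<Sum>i\<in>I. c i) / x)"
proof -
  have "{\<omega>\<in>space M. \<forall>i\<in>I. c i * V i \<omega> \<le> x} = (\<Inter>i\<in>I. V i -` {v. c i * v \<le> x} \<inter> space M)"
    using \<open>I \<noteq> {}\<close> by auto
  also have "prob \<dots> = (\<Prod>i\<in>I. prob (V i -` {v. c i * v \<le> x} \<inter> space M))"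
    by (rule indep_varsD_finite[OF assms(1)]) (use assms in auto)
  also have "\<dots> = (\<Prod>i\<in>I. exp (- c i / x))"
  proof (rule prod.cong)
    fix i assume "i \<in> I"
    have "V i -` {v. c i * v \<le> x} \<inter> space M = {\<omega>\<in>space M. c i * V i \<omega> \<le> x}" by auto
    then show "prob (V i -` {v. c i * v \<le> x} \<inter> space M) = exp (- c i / x)"
      using prob_scaled_frechet_le[of "V i" "c i" x] assms \<open>i \<in> I\<close> by simp
  qed simp
  also have "\<dots> = exp (- (\<Sum>i\<in>I. c i) / x)"
    using \<open>finite I\<close> by (simp add: exp_sum sum_divide_distrib flip: sum_negf)
  finally show ?thesis .
qed

section \<open>Tail dependence from the joint distribution function on the diagonal\<close>

text \<open>The ratio is 2 minus the difference quotient of \<open>u powr (2 - m)\<close> at 1, and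
  that function has derivative \<open>2 - m\<close> there.\<close>

lemma tendsto_upper_tail_ratio:
  "((\<lambda>u. (1 - 2 * u + u powr (2 - m)) / (1 - u)) \<longlongrightarrow> (m::real)) (at_left 1)"
proof -
  have "((\<lambda>u. u powr (2 - m)) has_real_derivative (2 - m)) (at 1)"
    by (auto intro!: derivative_eq_intros)
  then have "((\<lambda>u. (u powr (2 - m) - 1) / (u - 1)) \<longlongrightarrow> 2 - m) (at 1)"
    by (simp add: has_field_derivative_iff)
  then have "((\<lambda>u. (u powr (2 - m) - 1) / (u - 1)) \<longlongrightarrow> 2 - m) (at_left 1)"
    by (rule filterlim_at_split[THEN iffD1, THEN conjunct1])
  then have "((\<lambda>u. 2 - (u powr (2 - m) - 1) / (u - 1)) \<longlongrightarrow> 2 - (2 - m)) (at_left 1)"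
    by (intro tendsto_intros)
  moreover have "\<forall>\<^sub>F u in at_left 1. 2 - (u powr (2 - m) - 1) / (u - 1)
      = (1 - 2 * u + u powr (2 - m)) / (1 - u)"
    by (auto simp: eventually_at_filter divide_simps) (simp add: algebra_simps)
  ultimately show ?thesis
    by (simp add: filterlim_cong[OF refl refl])
qed

text \<open>If \<open>F(x) = e^(-C/x)\<close> is the common marginal and \<open>u = F(x)\<close>, then the joint distribution
  function at \<open>(x, x)\<close> is \<open>u^(2 - m)\<close>.\<close>

lemma (in prob_space) has_tail_dependence_frechet:
  assumes [measurable]: "X \<in> borel_measurable M" "Y \<in> borel_measurable M" and "C > 0"
    and X: "\<And>x. x > 0 \<Longrightarrow> \<P>(\<omega> in M. X \<omega> \<le> x) = exp (- C / x)"
    and Y: "\<And>x. x > 0 \<Longrightarrow> \<P>(\<omega> in M. Y \<omega> \<le> x) = exp (- C / x)"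
    and XY: "\<And>x. x > 0 \<Longrightarrow> \<P>(\<omega> in M. X \<omega> \<le> x \<and> Y \<omega> \<le> x) = exp (- ((2 - m) * C) / x)"
  shows "has_tail_dependence M X Y m"
proof -
  \<comment> \<open>This replaces the threshold \<open>exp (- C / x)\<close> for distribution
    function values by the threshold \<open>x\<close> for the variable itself. Above
    \<open>x\<close> the formula for the distribution function is strictly increasing; below,
    monotonicity suffices, which also covers \<open>t \<le> 0\<close>, where no formula is
    assumed.\<close>
  have exceed: "dist_fun M V t > exp (- C / x) \<longleftrightarrow> t > x"
    if [measurable]: "V \<in> borel_measurable M" and "x > 0"
      and V: "\<And>x. x > 0 \<Longrightarrow> \<P>(\<omega> in M. V \<omega> \<le> x) = exp (- C / x)" for V x t
  proof (cases "t > x")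
    case True
    with \<open>x > 0\<close> \<open>C > 0\<close> have "exp (- C / x) < exp (- C / t)"
      by (simp add: divide_strict_left_mono)
    with True \<open>x > 0\<close> V[of t] show ?thesis by (simp add: dist_fun_eq)
  next
    case False
    then have "dist_fun M V t \<le> dist_fun M V x"
      by (auto simp: dist_fun_eq intro!: finite_measure_mono)
    also have "\<dots> = exp (- C / x)" using V \<open>x > 0\<close> by (simp add: dist_fun_eq)
    finally show ?thesis using False by simp
  qed
  have "\<P>(\<omega> in M. dist_fun M X (X \<omega>) > u \<bar> dist_fun M Y (Y \<omega>) > u)
      = (1 - 2 * u + u powr (2 - m)) / (1 - u)" if "0 < u" "u < 1" for u
  proof -
    \<comment> \<open>The \<open>u\<close>-quantile of the common marginal, found by solving
      \<open>u = exp (- C / x)\<close>.\<close>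
    define x where "x = - C / ln u"
    have "ln u < 0" using that by simp
    then have "x > 0" using \<open>C > 0\<close> by (simp add: x_def divide_pos_neg divide_neg_neg)
    have u: "u = exp (- C / x)" using \<open>ln u < 0\<close> \<open>C > 0\<close> that by (simp add: x_def)
    \<comment> \<open>The hypotheses only concern events of the form \<open>\<le> x\<close>, hence
      the complement and then inclusion-exclusion.\<close>
    have "\<P>(\<omega> in M. X \<omega> > x \<and> Y \<omega> > x) = 1 - \<P>(\<omega> in M. X \<omega> \<le> x \<or> Y \<omega> \<le> x)"
      by (subst prob_compl[symmetric]) (auto intro!: arg_cong[where f=prob])
    also have "{\<omega>\<in>space M. X \<omega> \<le> x \<or> Y \<omega> \<le> x}
        = {\<omega>\<in>space M. X \<omega> \<le> x} \<union> {\<omega>\<in>space M. Y \<omega> \<le> x}" by auto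
    also have "prob \<dots> = \<P>(\<omega> in M. X \<omega> \<le> x) + \<P>(\<omega> in M. Y \<omega> \<le> x)
        - \<P>(\<omega> in M. X \<omega> \<le> x \<and> Y \<omega> \<le> x)"
      by (subst measure_Un3) (auto simp: fmeasurable_eq_sets intro!: arg_cong[where f=prob])
    also have "\<dots> = 2 * u - exp (- ((2 - m) * C) / x)"
      using X Y XY \<open>x > 0\<close> by (simp add: u)
    also have "exp (- ((2 - m) * C) / x) = u powr (2 - m)"
      by (simp add: u powr_def)
    finally have both: "\<P>(\<omega> in M. X \<omega> > x \<and> Y \<omega> > x) = 1 - 2 * u + u powr (2 - m)" by simp
    have "\<P>(\<omega> in M. Y \<omega> > x) = 1 - \<P>(\<omega> in M. Y \<omega> \<le> x)"
      by (subst prob_compl[symmetric]) (auto intro!: arg_cong[where f=prob])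
    then have "\<P>(\<omega> in M. Y \<omega> > x) = 1 - u" using Y \<open>x > 0\<close> by (simp add: u)
    moreover have "dist_fun M X t > u \<longleftrightarrow> t > x" "dist_fun M Y t > u \<longleftrightarrow> t > x" for t
      using exceed[of X x t] exceed[of Y x t] X Y \<open>x > 0\<close> by (simp_all add: u)
    ultimately show ?thesis by (simp add: cond_prob_def both)
  qed
  then have "\<forall>\<^sub>F u in at_left 1. (1 - 2 * u + u powr (2 - m)) / (1 - u)
      = \<P>(\<omega> in M. dist_fun M X (X \<omega>) > u \<bar> dist_fun M Y (Y \<omega>) > u)"
    using eventually_at_left_real[of 0 1] by (auto elim: eventually_mono)
  from Lim_transform_eventually[OF tendsto_upper_tail_ratio this]
  show ?thesis unfolding has_tail_dependence_def .
qed

section \<open>Tail dependence of max-mixture vectors\<close>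

text \<open>By max-stability the joint distribution function of two components at
  \<open>(x, x)\<close> is again \<open>exp (- K / x)\<close> for a constant \<open>K\<close>. As a
  maximum is the sum minus the minimum, \<open>K\<close> is \<open>2 * C\<close> less the sum of the
  minima.\<close>

lemma max_mixture_tail_dependence:
  assumes "max_mixture_vector M d D \<alpha> C X" "s \<in> {1..d}" "k \<in> {1..d}" "s \<noteq> k"
  shows "has_tail_dependence M (X s) (X k) ((\<Sum>j=1..D. min (\<alpha> s j) (\<alpha> k j)) / C)"
proof -
  from assms(1) interpret prob_space M by (simp add: max_mixture_vector_def)
  from assms(1) obtain Y Z where "C > 0" "D \<ge> 1"
    and \<alpha>: "\<And>i j. i \<in> {1..d} \<Longrightarrow> j \<in> {1..D} \<Longrightarrow> \<alpha> i j \<ge> 0"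
    and Cmax: "C \<ge> (MAX i\<in>{1..d}. \<Sum>j=1..D. \<alpha> i j)"
    and Y: "\<And>i. i \<in> {1..d} \<Longrightarrow> unit_frechet M (Y i)"
    and Z: "\<And>j. j \<in> {1..D} \<Longrightarrow> unit_frechet M (Z j)"
    and indep: "indep_vars (\<lambda>_. borel) (case_sum Y Z) ({1..d} <+> {1..D})"
    and X: "\<And>i \<omega>. i \<in> {1..d} \<Longrightarrow> \<omega> \<in> space M \<Longrightarrow>
      X i \<omega> = max (MAX j\<in>{1..D}. \<alpha> i j * Z j \<omega>) ((C - (\<Sum>j=1..D. \<alpha> i j)) * Y i \<omega>)"
    unfolding max_mixture_vector_def by blast
  have C: "(\<Sum>j=1..D. \<alpha> i j) \<le> C" if "i \<in> {1..d}" for i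
    by (rule order_trans[OF Max_ge Cmax]) (use that in auto)
  have meas: "X i \<in> borel_measurable M" if i: "i \<in> {1..d}" for i
  proof -
    have "(\<lambda>\<omega>. MAX j\<in>{1..D}. \<alpha> i j * Z j \<omega>) \<in> borel_measurable M"
      using Z by (intro borel_measurable_Max borel_measurable_times) (auto simp: unit_frechet_def)
    then have "(\<lambda>\<omega>. max (MAX j\<in>{1..D}. \<alpha> i j * Z j \<omega>) ((C - (\<Sum>j=1..D. \<alpha> i j)) * Y i \<omega>))
        \<in> borel_measurable M"
      using Y[OF i] by (auto simp: unit_frechet_def)
    then show ?thesis using X[OF i] by (simp cong: measurable_cong)
  qed
  have X_le: "X i \<omega> \<le> x \<longleftrightarrow>
      (\<forall>j\<in>{1..D}. \<alpha> i j * Z j \<omega> \<le> x) \<and> (C - (\<Sum>j=1..D. \<alpha> i j)) * Y i \<omega> \<le> x"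
    if "i \<in> {1..d}" "\<omega> \<in> space M" for i \<omega> x
    using X[OF that] \<open>D \<ge> 1\<close> by (auto simp: Max_le_iff)
  \<comment> \<open>The Frechet variables are positive only almost surely, so negative
    \<open>z\<close> has to be treated as well: both products are then at most 0, hence below
    \<open>x\<close>.\<close>
  have max_mult_le: "max a b * z \<le> x \<longleftrightarrow> a * z \<le> x \<and> b * z \<le> x"
    if "a \<ge> 0" "b \<ge> 0" "x > 0" for a b z x :: real
  proof (cases "z \<ge> 0")
    case True
    then show ?thesis by (simp add: max_mult_distrib_right)
  next
    case False
    then have "c * z \<le> x" if "c \<ge> 0" for c
      using that \<open>x > 0\<close> mult_nonneg_nonpos[of c z] by linarith
    then show ?thesis using that by simp
  qed
  \<comment> \<open>Summing over the set \<open>{p,q}\<close> instead of two terms keeps the formula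
    correct for \<open>p = q\<close>, so it yields the marginals too.\<close>
  have joint: "\<P>(\<omega> in M. X p \<omega> \<le> x \<and> X q \<omega> \<le> x)
      = exp (- ((\<Sum>i\<in>{p,q}. C - (\<Sum>j=1..D. \<alpha> i j)) + (\<Sum>j=1..D. max (\<alpha> p j) (\<alpha> q j))) / x)"
    if pq: "p \<in> {1..d}" "q \<in> {1..d}" and "x > 0" for p q x
  proof -
    \<comment> \<open>Coefficient 0 for the remaining \<open>Y i\<close> lets the event be written
      over the whole independent family, since \<open>0 \<le> x\<close> always holds.\<close>
    define b where "b i = (if i \<in> {p,q} then C - (\<Sum>j=1..D. \<alpha> i j) else 0)" for i
    define c where "c = case_sum b (\<lambda>j. max (\<alpha> p j) (\<alpha> q j))"
    have "X p \<omega> \<le> x \<and> X q \<omega> \<le> x \<longleftrightarrow>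
        (\<forall>l\<in>{1..d} <+> {1..D}. c l * case_sum Y Z l \<omega> \<le> x)" if "\<omega> \<in> space M" for \<omega>
    proof -
      have "(\<forall>l\<in>{1..d} <+> {1..D}. c l * case_sum Y Z l \<omega> \<le> x) \<longleftrightarrow>
          (\<forall>i\<in>{1..d}. b i * Y i \<omega> \<le> x) \<and> (\<forall>j\<in>{1..D}. max (\<alpha> p j) (\<alpha> q j) * Z j \<omega> \<le> x)"
        by (auto simp: c_def ball_Un Plus_def)
      also have "(\<forall>i\<in>{1..d}. b i * Y i \<omega> \<le> x) \<longleftrightarrow> (\<forall>i\<in>{p,q}. b i * Y i \<omega> \<le> x)"
        using pq \<open>x > 0\<close> by (auto simp: b_def)
      also have "(\<forall>j\<in>{1..D}. max (\<alpha> p j) (\<alpha> q j) * Z j \<omega> \<le> x) \<longleftrightarrow>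
          (\<forall>j\<in>{1..D}. \<alpha> p j * Z j \<omega> \<le> x \<and> \<alpha> q j * Z j \<omega> \<le> x)"
        using max_mult_le \<alpha> pq \<open>x > 0\<close> by (intro ball_cong) auto
      finally show ?thesis using X_le pq that by (auto simp: b_def)
    qed
    then have "\<P>(\<omega> in M. X p \<omega> \<le> x \<and> X q \<omega> \<le> x)
        = \<P>(\<omega> in M. \<forall>l\<in>{1..d} <+> {1..D}. c l * case_sum Y Z l \<omega> \<le> x)"
      by (simp cong: conj_cong)
    also have "\<dots> = exp (- (\<Sum>l\<in>{1..d} <+> {1..D}. c l) / x)"
    proof (rule prob_all_scaled_frechet_le[OF indep])
      show "c l \<ge> 0" if "l \<in> {1..d} <+> {1..D}" for l
        using that \<alpha> C pq by (auto simp: c_def b_def le_max_iff_disj)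
    qed (use Y Z \<open>D \<ge> 1\<close> \<open>x > 0\<close> in auto)
    also have "(\<Sum>l\<in>{1..d} <+> {1..D}. c l)
        = (\<Sum>i=1..d. b i) + (\<Sum>j=1..D. max (\<alpha> p j) (\<alpha> q j))"
      by (simp add: sum.Plus c_def)
    also have "(\<Sum>i=1..d. b i) = (\<Sum>i\<in>{p,q}. C - (\<Sum>j=1..D. \<alpha> i j))"
      using pq unfolding b_def by (subst sum.inter_restrict[symmetric]) (auto intro!: sum.cong)
    finally show ?thesis .
  qed
  \<comment> \<open>For \<open>p = q\<close> the sums of coefficients cancel and only
    \<open>C\<close> remains, so all components have the same marginal.\<close>
  have marginal: "\<P>(\<omega> in M. X i \<omega> \<le> x) = exp (- C / x)" if "i \<in> {1..d}" "x > 0" for i x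
    using joint[OF that(1,1,2)] by simp
  show ?thesis
  proof (rule has_tail_dependence_frechet[OF meas meas \<open>C > 0\<close> marginal marginal])
    fix x :: real assume "x > 0"
    have "(\<Sum>j=1..D. max (\<alpha> s j) (\<alpha> k j)) + (\<Sum>j=1..D. min (\<alpha> s j) (\<alpha> k j))
        = (\<Sum>j=1..D. \<alpha> s j) + (\<Sum>j=1..D. \<alpha> k j)"
      by (simp add: max_def min_def flip: sum.distrib) (auto intro!: sum.cong)
    then have "(\<Sum>i\<in>{s,k}. C - (\<Sum>j=1..D. \<alpha> i j)) + (\<Sum>j=1..D. max (\<alpha> s j) (\<alpha> k j))
        = (2 - (\<Sum>j=1..D. min (\<alpha> s j) (\<alpha> k j)) / C) * C"
      using \<open>s \<noteq> k\<close> \<open>C > 0\<close> by (simp add: left_diff_distrib)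
    with joint[OF assms(2,3) \<open>x > 0\<close>]
    show "\<P>(\<omega> in M. X s \<omega> \<le> x \<and> X k \<omega> \<le> x)
        = exp (- ((2 - (\<Sum>j=1..D. min (\<alpha> s j) (\<alpha> k j)) / C) * C) / x)" by (simp only:)
  qed (use assms in auto)
qed

section \<open>Existence of independent unit Frechet variables\<close>

definition frechet_cdf :: "real \<Rightarrow> real" where
  "frechet_cdf x = (if x > 0 then exp (- 1 / x) else 0)"

lemma
  shows real_distribution_frechet: "real_distribution (interval_measure frechet_cdf)"
    and cdf_frechet: "cdf (interval_measure frechet_cdf) = frechet_cdf"
proof -
  have mono: "frechet_cdf x \<le> frechet_cdf y" if "x \<le> y" for x y
    using that by (auto simp: frechet_cdf_def field_simps)
  have right_cont: "continuous (at_right a) frechet_cdf" for a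
  proof -
    consider "a < 0" | "a = 0" | "a > 0" by linarith
    then have "(frechet_cdf \<longlongrightarrow> frechet_cdf a) (at_right a)"
    proof cases
      case 1
      then have "\<forall>\<^sub>F x in at_right a. 0 = frechet_cdf x"
        using eventually_at_right_real[of a 0]
        by (auto elim!: eventually_mono simp: frechet_cdf_def)
      from Lim_transform_eventually[OF tendsto_const this]
      have "(frechet_cdf \<longlongrightarrow> 0) (at_right a)" .
      with 1 show ?thesis by (simp add: frechet_cdf_def[of a])
    next
      case 2
      \<comment> \<open>The two branches of \<open>frechet_cdf\<close> meet at 0; right continuity
        there means that \<open>exp (- 1 / x)\<close> vanishes as \<open>x\<close> decreases to
        0.\<close>
      have "((\<lambda>x::real. exp (- 1 / x)) \<longlongrightarrow> 0) (at_right 0)" by real_asymp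
      moreover have "\<forall>\<^sub>F x in at_right 0. exp (- 1 / x) = frechet_cdf x"
        by (auto simp: eventually_at_filter frechet_cdf_def)
      ultimately show ?thesis
        using 2 Lim_transform_eventually by (fastforce simp: frechet_cdf_def)
    next
      case 3
      then have "((\<lambda>x. exp (- 1 / x)) \<longlongrightarrow> exp (- 1 / a)) (at_right a)"
        by (intro tendsto_intros) auto
      moreover have "\<forall>\<^sub>F x in at_right a. exp (- 1 / x) = frechet_cdf x"
        using 3 by (auto simp: eventually_at_filter frechet_cdf_def)
      ultimately show ?thesis
        using 3 Lim_transform_eventually by (fastforce simp: frechet_cdf_def)
    qed
    then show ?thesis by (simp add: continuous_within)
  qed
  have "\<forall>\<^sub>F x in at_bot. 0 = frechet_cdf x"
    by (rule eventually_mono[OF eventually_le_at_bot[of 0]]) (simp add: frechet_cdf_def)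
  from Lim_transform_eventually[OF tendsto_const this]
  have at_bot: "(frechet_cdf \<longlongrightarrow> 0) at_bot" .
  have "((\<lambda>x::real. exp (- 1 / x)) \<longlongrightarrow> 1) at_top" by real_asymp
  moreover have "\<forall>\<^sub>F x in at_top. exp (- 1 / x) = frechet_cdf x"
    by (rule eventually_mono[OF eventually_gt_at_top[of 0]]) (simp add: frechet_cdf_def)
  ultimately have "(frechet_cdf \<longlongrightarrow> 1) at_top" by (rule Lim_transform_eventually)
  with mono right_cont at_bot show "real_distribution (interval_measure frechet_cdf)"
    by (rule real_distribution_interval_measure)
  show "cdf (interval_measure frechet_cdf) = frechet_cdf"
    using mono right_cont at_bot by (rule cdf_interval_measure)
qed

text \<open>The variables are coordinates under a product of Frechet laws. The map \<open>f\<close>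
  encodes the indices in another type; its injectivity makes distinct indices read distinct
  coordinates, so the joint law is again a product.\<close>

lemma ex_indep_unit_frechet:
  assumes "inj_on f I"
  obtains N :: "('k \<Rightarrow> real) measure" where "prob_space N"
    and "\<And>i. unit_frechet N (\<lambda>\<omega>. \<omega> (f i :: 'k))"
    and "I \<noteq> {} \<Longrightarrow> prob_space.indep_vars N (\<lambda>_. borel) (\<lambda>i \<omega>. \<omega> (f i)) I"
proof
  define P where "P = interval_measure frechet_cdf"
  interpret P: real_distribution P using real_distribution_frechet by (simp add: P_def)
  define N where "N = Pi\<^sub>M (UNIV :: 'k set) (\<lambda>_. P)"
  \<comment> \<open>\<open>distr\<close> sees only the measurable structure of its target, so
    \<open>P\<close> and \<open>borel\<close> may be exchanged there.\<close>
  have [measurable_cong]: "sets P = sets borel" by simp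
  interpret N: prob_space N unfolding N_def by (intro prob_space_PiM P.prob_space_axioms)
  show "prob_space N" by (rule N.prob_space_axioms)
  have meas: "(\<lambda>\<omega>. \<omega> k) \<in> borel_measurable N" for k
    unfolding N_def by measurable
  have distr: "distr N borel (\<lambda>\<omega>. \<omega> k) = P" for k
  proof -
    have "distr N borel (\<lambda>\<omega>. \<omega> k) = distr N P (\<lambda>\<omega>. \<omega> k)" by (rule distr_cong) auto
    also have "\<dots> = P" unfolding N_def
      by (rule distr_PiM_component) (auto intro: P.prob_space_axioms)
    finally show ?thesis .
  qed
  show "unit_frechet N (\<lambda>\<omega>. \<omega> (f i))" for i
    using meas by (simp add: unit_frechet_def dist_fun_def distr P_def cdf_frechet frechet_cdf_def)
  show "N.indep_vars (\<lambda>_. borel) (\<lambda>i \<omega>. \<omega> (f i)) I" if "I \<noteq> {}"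
  proof (subst N.indep_vars_iff_distr_eq_PiM'[OF that meas])
    have "distr N (Pi\<^sub>M I (\<lambda>_. borel)) (\<lambda>\<omega>. \<lambda>i\<in>I. \<omega> (f i))
        = distr N (Pi\<^sub>M I (\<lambda>_. P)) (\<lambda>\<omega>. \<lambda>i\<in>I. \<omega> (f i))"
      by (intro distr_cong sets_PiM_cong) auto
    also have "\<dots> = Pi\<^sub>M I (\<lambda>_. P)" unfolding N_def
      using distr_PiM_reindex[where K = UNIV and M = "\<lambda>_. P" and f = f and I = I]
        assms P.prob_space_axioms by simp
    finally show "distr N (Pi\<^sub>M I (\<lambda>_. borel)) (\<lambda>\<omega>. \<lambda>i\<in>I. \<omega> (f i))
        = (\<Pi>\<^sub>M i\<in>I. distr N borel (\<lambda>\<omega>. \<omega> (f i)))" by (simp add: distr)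
  qed
qed

text \<open>Every admissible choice of parameters is realised, so afterwards only the coefficients
  remain to be chosen.\<close>

lemma ex_max_mixture_vector:
  assumes "d \<ge> 2" "D \<ge> 1" "C > 0"
    and "\<And>i j. i \<in> {1..d} \<Longrightarrow> j \<in> {1..D} \<Longrightarrow> \<alpha> i j \<ge> 0"
    and "\<And>i. i \<in> {1..d} \<Longrightarrow> (\<Sum>j=1..D. \<alpha> i j) \<le> C"
  obtains N :: "(nat \<Rightarrow> real) measure" and X where "max_mixture_vector N d D \<alpha> C X"
proof -
  \<comment> \<open>Encodes the disjoint sum in the naturals: \<open>Y i\<close> reads coordinate
    \<open>i\<close> and \<open>Z j\<close> coordinate \<open>d + j\<close>, and these ranges do not
    meet.\<close>
  define f where "f = case_sum id (\<lambda>j. d + j)"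
  have "inj_on f ({1..d} <+> {1..D})"
    by (auto simp: f_def inj_on_def)
  from ex_indep_unit_frechet[OF this]
  obtain N :: "(nat \<Rightarrow> real) measure" where "prob_space N"
    and frechet: "\<And>i. unit_frechet N (\<lambda>\<omega>. \<omega> (f i))"
    and indep: "{1..d} <+> {1..D} \<noteq> {} \<Longrightarrow>
      prob_space.indep_vars N (\<lambda>_. borel) (\<lambda>i \<omega>. \<omega> (f i)) ({1..d} <+> {1..D})"
    by blast
  define Y Z :: "nat \<Rightarrow> (nat \<Rightarrow> real) \<Rightarrow> real"
    where "Y i \<omega> = \<omega> (f (Inl i))" and "Z j \<omega> = \<omega> (f (Inr j))" for i j \<omega>
  have "case_sum Y Z = (\<lambda>i \<omega>. \<omega> (f i))"
    by (auto simp: fun_eq_iff Y_def Z_def split: sum.split)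
  moreover have "{1..d} <+> {1..D} \<noteq> {}" using \<open>D \<ge> 1\<close> by auto
  ultimately have "prob_space.indep_vars N (\<lambda>_. borel) (case_sum Y Z) ({1..d} <+> {1..D})"
    using indep by simp
  moreover have "unit_frechet N (Y i)" "unit_frechet N (Z i)" for i
    using frechet[of "Inl i"] frechet[of "Inr i"] by (simp_all add: Y_def[abs_def] Z_def[abs_def])
  moreover have "(MAX i\<in>{1..d}. \<Sum>j=1..D. \<alpha> i j) \<le> C"
    using assms by (subst Max_le_iff) auto
  ultimately have "max_mixture_vector N d D \<alpha> C (\<lambda>i \<omega>.
      max (MAX j\<in>{1..D}. \<alpha> i j * Z j \<omega>) ((C - (\<Sum>j=1..D. \<alpha> i j)) * Y i \<omega>))"
    using assms \<open>prob_space N\<close> unfolding max_mixture_vector_def by blast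
  with that show ?thesis .
qed

section \<open>Realising a prescribed family of coefficients\<close>

text \<open>A limit of conditional probabilities. The values of \<open>lam\<close> will serve as
  mixture coefficients, which must be nonnegative.\<close>

lemma has_tail_dependence_nonneg:
  assumes "has_tail_dependence M X Y l"
  shows "l \<ge> 0"
  using assms unfolding has_tail_dependence_def
  by (rule tendsto_lowerbound) (auto simp: cond_prob_def)

text \<open>One common factor for each pair \<open>a < b\<close>, with coefficient \<open>lam a b\<close> in the components
  \<open>a\<close> and \<open>b\<close> and coefficient 0 in all others.\<close>

lemma ex_max_mixture_tail_dependence:
  fixes lam :: "nat \<Rightarrow> nat \<Rightarrow> real"
  assumes "d \<ge> 2"
    and nonneg: "\<And>s k. s \<in> {1..d} \<Longrightarrow> k \<in> {1..d} \<Longrightarrow> s \<noteq> k \<Longrightarrow> lam s k \<ge> 0"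
    and sym: "\<And>s k. s \<in> {1..d} \<Longrightarrow> k \<in> {1..d} \<Longrightarrow> s \<noteq> k \<Longrightarrow> lam s k = lam k s"
    and row: "\<And>i. i \<in> {1..d} \<Longrightarrow> (\<Sum>k\<in>{1..d} - {i}. lam i k) \<le> 1"
  shows "\<exists>(N :: (nat \<Rightarrow> real) measure) D \<alpha> C X.
    max_mixture_vector N d D \<alpha> C X \<and> has_tail_dependence_family N d X lam"
proof -
  define P where "P = {(a, b). a \<in> {1..d} \<and> b \<in> {1..d} \<and> a < b}"
  have "finite P" by (rule finite_subset[of _ "{1..d} \<times> {1..d}"]) (auto simp: P_def)
  \<comment> \<open>A max-mixture needs at least one factor, and \<open>d \<ge> 2\<close> provides a
    pair.\<close>
  moreover have "(1, 2) \<in> P" using \<open>d \<ge> 2\<close> by (simp add: P_def)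
  ultimately have "card P \<ge> 1" using card_gt_0_iff[of P] by fastforce
  obtain e where e: "bij_betw e {1..card P} P"
    using ex_bij_betw_nat_finite_1[OF \<open>finite P\<close>] by blast
  define w where "w i p = (if i = fst p \<or> i = snd p then lam (fst p) (snd p) else 0)"
    for i and p :: "nat \<times> nat"
  define \<alpha> where "\<alpha> i j = w i (e j)" for i j
  have w_nonneg: "w i p \<ge> 0" if "p \<in> P" for i p
    using that nonneg by (auto simp: w_def P_def)
  have "(\<Sum>j=1..card P. \<alpha> i j) \<le> 1" if i: "i \<in> {1..d}" for i
  proof -
    have "(\<Sum>j=1..card P. \<alpha> i j) = (\<Sum>p\<in>P. w i p)"
      unfolding \<alpha>_def by (rule sum.reindex_bij_betw[OF e])
    also have "\<dots> = (\<Sum>p | p \<in> P \<and> (i = fst p \<or> i = snd p). w i p)"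
      using \<open>finite P\<close> by (intro sum.mono_neutral_right) (auto simp: w_def)
    also have "\<dots> = (\<Sum>k\<in>{1..d} - {i}. lam i k)"
    \<comment> \<open>A pair containing \<open>i\<close> corresponds to its other member. Symmetry
      of \<open>lam\<close> is used when \<open>i\<close> is the larger one.\<close>
    proof (rule sum.reindex_bij_witness[where
          i = "\<lambda>k. (min i k, max i k)" and j = "\<lambda>p. if i = fst p then snd p else fst p"])
      show "lam i (if i = fst p then snd p else fst p) = w i p"
        if "p \<in> {p \<in> P. i = fst p \<or> i = snd p}" for p
        using that sym[of i "fst p"] by (auto simp: w_def P_def)
    qed (use i in \<open>auto simp: P_def min_def max_def\<close>)
    also have "\<dots> \<le> 1" by (rule row[OF i])
    finally show ?thesis .
  qed
  moreover have "\<alpha> i j \<ge> 0" if "j \<in> {1..card P}" for i j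
    using bij_betwE[OF e] that w_nonneg by (auto simp: \<alpha>_def)
  ultimately obtain N :: "(nat \<Rightarrow> real) measure" and X
    where X: "max_mixture_vector N d (card P) \<alpha> 1 X"
    using ex_max_mixture_vector[of d "card P" 1 \<alpha>] \<open>d \<ge> 2\<close> \<open>card P \<ge> 1\<close> by (metis zero_less_one)
  have "has_tail_dependence N (X s) (X k) (lam s k)"
    if sk: "s \<in> {1..d}" "k \<in> {1..d}" "s \<noteq> k" for s k
  proof -
    have "(\<Sum>j=1..card P. min (\<alpha> s j) (\<alpha> k j)) = (\<Sum>p\<in>P. min (w s p) (w k p))"
      unfolding \<alpha>_def by (rule sum.reindex_bij_betw[OF e])
    \<comment> \<open>Only one pair contains both \<open>s\<close> and \<open>k\<close>; for any
      other, one weight is 0 and the other nonnegative, so the minimum is 0.\<close>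
    also have "\<dots> = (\<Sum>p\<in>{(min s k, max s k)}. min (w s p) (w k p))"
    proof (rule sum.mono_neutral_right)
      show "\<forall>p\<in>P - {(min s k, max s k)}. min (w s p) (w k p) = 0"
      proof
        fix p assume p: "p \<in> P - {(min s k, max s k)}"
        then have "w s p = 0 \<or> w k p = 0"
          using sk by (auto simp: P_def w_def min_def max_def)
        with w_nonneg[of p s] w_nonneg[of p k] p show "min (w s p) (w k p) = 0" by auto
      qed
    qed (use \<open>finite P\<close> sk in \<open>auto simp: P_def min_def max_def\<close>)
    also have "\<dots> = lam s k" using sym[OF sk] by (auto simp: w_def min_def max_def)
    finally show ?thesis using max_mixture_tail_dependence[OF X sk] by simp
  qed
  with X show ?thesis unfolding has_tail_dependence_family_def by blast
qed

theorem proposition2p3: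
  fixes M :: "'a measure" and W :: "nat \<Rightarrow> 'a \<Rightarrow> real"
    and lam :: "nat \<Rightarrow> nat \<Rightarrow> real" and d :: nat
  assumes "d \<ge> 2"
    and "prob_space M"
    and "\<And>i. i \<in> {1..d} \<Longrightarrow> W i \<in> borel_measurable M"
    and "has_tail_dependence_family M d W lam"
    and "\<And>s k. s \<in> {1..d} \<Longrightarrow> k \<in> {1..d} \<Longrightarrow> s \<noteq> k \<Longrightarrow> lam s k = lam k s"
  shows "((\<forall>i\<in>{1..d}.
              (\<Sum>j\<in>{1..<i}. MAX k\<in>{j+1..d}. lam j k) + (\<Sum>j\<in>{i+1..d}. lam i j) \<le> 1)
            \<longrightarrow> (\<exists>(N :: (nat \<Rightarrow> real) measure) D \<alpha> C X.
                  max_mixture_vector N d D \<alpha> C X \<and> has_tail_dependence_family N d X lam))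
       \<and> ((\<forall>s k. 1 \<le> s \<and> s < k \<and> k \<le> d \<longrightarrow> lam s k \<le> 1 / (real d - 1))
            \<longrightarrow> (\<exists>(N :: (nat \<Rightarrow> real) measure) D \<alpha> C X.
                  max_mixture_vector N d D \<alpha> C X \<and> has_tail_dependence_family N d X lam))"
proof -
  have nonneg: "lam s k \<ge> 0" if "s \<in> {1..d}" "k \<in> {1..d}" "s \<noteq> k" for s k
    using assms(4) that
    by (intro has_tail_dependence_nonneg[of M "W s" "W k"]) (simp add: has_tail_dependence_family_def)
  \<comment> \<open>With nonnegativity and symmetry supplied, the bound on the row sums is the only
    remaining obligation in both parts.\<close>
  note construct = ex_max_mixture_tail_dependence[OF assms(1) nonneg assms(5)]
  show ?thesis
  proof (intro conjI impI construct)
    fix i assume i: "i \<in> {1..d}"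
      and *: "\<forall>i\<in>{1..d}.
        (\<Sum>j\<in>{1..<i}. MAX k\<in>{j+1..d}. lam j k) + (\<Sum>j\<in>{i+1..d}. lam i j) \<le> 1"
    have "{1..d} - {i} = {1..<i} \<union> {i+1..d}" using i by auto
    moreover have "sum (lam i) ({1..<i} \<union> {i+1..d}) = sum (lam i) {1..<i} + sum (lam i) {i+1..d}"
      by (rule sum.union_disjoint) auto
    ultimately have split: "sum (lam i) ({1..d} - {i}) = sum (lam i) {1..<i} + sum (lam i) {i+1..d}"
      by metis
    \<comment> \<open>For \<open>j < i\<close> the index \<open>i\<close> lies in
      \<open>{j+1..d}\<close>, so \<open>lam j i\<close> is one of the values under the
      maximum.\<close>
    have "(\<Sum>j\<in>{1..<i}. lam i j) \<le> (\<Sum>j\<in>{1..<i}. MAX k\<in>{j+1..d}. lam j k)"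
    proof (rule sum_mono)
      fix j assume j: "j \<in> {1..<i}"
      then have "lam i j = lam j i" using assms(5) i by auto
      also have "\<dots> \<le> (MAX k\<in>{j+1..d}. lam j k)" by (rule Max_ge) (use i j in auto)
      finally show "lam i j \<le> (MAX k\<in>{j+1..d}. lam j k)" .
    qed
    with *[rule_format, OF i] split show "(\<Sum>k\<in>{1..d} - {i}. lam i k) \<le> 1" by linarith
  next
    fix i assume i: "i \<in> {1..d}"
      and *: "\<forall>s k. 1 \<le> s \<and> s < k \<and> k \<le> d \<longrightarrow> lam s k \<le> 1 / (real d - 1)"
    have "lam i k \<le> 1 / (real d - 1)" if "k \<in> {1..d} - {i}" for k
    \<comment> \<open>The hypothesis bounds only entries with the smaller index first; the others
      follow by symmetry.\<close>
    proof (cases "i < k")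
      case True
      with * i that show ?thesis by simp
    next
      case False
      with i that have "lam k i \<le> 1 / (real d - 1)" by (intro *[rule_format]) auto
      with assms(5)[of i k] i that show ?thesis by simp
    qed
    \<comment> \<open>There are \<open>d - 1\<close> terms, each at most
      \<open>1 / (real d - 1)\<close>, and \<open>d \<ge> 2\<close> keeps the denominator
      nonzero.\<close>
    then have "(\<Sum>k\<in>{1..d} - {i}. lam i k) \<le> of_nat (card ({1..d} - {i})) * (1 / (real d - 1))"
      by (rule sum_bounded_above)
    also have "card ({1..d} - {i}) = d - 1" using i by simp
    finally show "(\<Sum>k\<in>{1..d} - {i}. lam i k) \<le> 1" using assms(1) by (simp add: of_nat_diff)
  qed
qed

end
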